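(* If a probabilistic automaton $\mathcal{A}$ is leaktight, then its Markov monoid is complete for $\mathcal{A}$: for every sequence of words $(u_n)_{n\in\mathbb{N}}$ there exists a limit-word $\mathbf{u}$ in the Markov monoid of $\mathcal{A}$ such that for all states $s,t$, $\limsup_n \mathbb{P}_{\mathcal{A}}(s\xrightarrow{u_n}t)=0$ implies $\mathbf{u}(s,t)=0$.
   Context: Fix a finite alphabet $A$. A probabilistic automaton is $\mathcal{A}=(Q,q_0,\Delta,F)$ with $Q$ finite, $q_0\in Q$, $F\subseteq Q$ and $\Delta: Q\times A\to\mathcal{D}(Q)$. For $a\in A$ let $M_a(s,t)=\Delta(s,a)(t)$, for $u=a_0\cdots a_{n-1}$ let $M_u=M_{a_0}\cdots M_{a_{n-1}}$ (identity for the empty word), and $\mathbb{P}_{\mathcal{A}}(s\xrightarrow{u}t)=M_u(s,t)$. A limit-word is a map $\mathbf{u}:Q\times Q\to\{0,1\}$ such that every $s$ has some $t$ with $\mathbf{u}(s,t)=1$. Concatenation: $(\mathbf{u}\cdot\mathbf{v})(s,t)=1$ iff there is $q$ with $\mathbf{u}(s,q)=\mathbf{v}(q,t)=1$. $\mathbf{u}$ is idempotent if $\mathbf{u}\cdot\mathbf{u}=\mathbf{u}$; for idempotent $\mathbf{u}$, $s$ is $\mathbf{u}$-recurrent if for all $t$, $\mathbf{u}(s,t)=1\Rightarrow\mathbf{u}(t,s)=1$, and $\mathbf{u}^\sharp(s,t)=1$ iff $\mathbf{u}(s,t)=1$ and $t$ is $\mathbf{u}$-recurrent. For $a\in A$,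 $\mathbf{a}(s,t)=1$ iff $\Delta(s,a)(t)>0$; $\mathbf{1}$ is the identity limit-word. The Markov monoid of $\mathcal{A}$ is the smallest set of limit-words containing $\{\mathbf{a}\mid a\in A\}\cup\{\mathbf{1}\}$, closed under concatenation and under iteration of idempotent elements. A nonnegative $Q\times Q$ matrix $M$ is idempotent if $M(s,t)>0\iff M^2(s,t)>0$ for all $s,t$; a word $u$ is idempotent if $M_u$ is. A leak is a sequence $(u_n)$ of idempotent words such that $M_{u_n}$ converges to an idempotent matrix $M$ and there exist states $r,q$, both recurrent in the Markov chain with transition matrix $M$, with $\lim_n\mathbb{P}_{\mathcal{A}}(r\xrightarrow{u_n}q)=0$ and $\mathbb{P}_{\mathcal{A}}(r\xrightarrow{u_n}q)>0$ for all $n$. $\mathcal{A}$ is leaktight if it has no leak. *)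

theory Defs
  imports "HOL-Probability.Probability_Mass_Function" "HOL-Library.Liminf_Limsup"
begin

record ('q, 'a) pa =
  init  :: 'q
  trans :: "'q \<Rightarrow> 'a \<Rightarrow> 'q pmf"
  final :: "'q set"

type_synonym 'q mat = "'q \<Rightarrow> 'q \<Rightarrow> real"

definition mat_mult :: "'q::finite mat \<Rightarrow> 'q mat \<Rightarrow> 'q mat" where
  "mat_mult M N = (\<lambda>s t. \<Sum>q\<in>UNIV. M s q * N q t)"

definition mat_one :: "'q mat" where
  "mat_one = (\<lambda>s t. if s = t then 1 else 0)"

definition letter_mat :: "('q, 'a) pa \<Rightarrow> 'a \<Rightarrow> 'q mat" where
  "letter_mat A a = (\<lambda>s t. pmf (trans A s a) t)"

fun word_mat :: "('q::finite, 'a) pa \<Rightarrow> 'a list \<Rightarrow> 'q mat" where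
  "word_mat A [] = mat_one"
| "word_mat A (a # u) = mat_mult (letter_mat A a) (word_mat A u)"

definition prob_path :: "('q::finite, 'a) pa \<Rightarrow> 'q \<Rightarrow> 'a list \<Rightarrow> 'q \<Rightarrow> real" where
  "prob_path A s u t = word_mat A u s t"

definition idempotent_mat :: "'q::finite mat \<Rightarrow> bool" where
  "idempotent_mat M \<longleftrightarrow> (\<forall>s t. M s t > 0 \<longleftrightarrow> mat_mult M M s t > 0)"

definition idempotent_word :: "('q::finite, 'a) pa \<Rightarrow> 'a list \<Rightarrow> bool" where
  "idempotent_word A u \<longleftrightarrow> idempotent_mat (word_mat A u)"

definition mc_recurrent :: "'q mat \<Rightarrow> 'q \<Rightarrow> bool" where
  "mc_recurrent M r \<longleftrightarrow>
     (\<forall>t. (r, t) \<in> {(x, y). M x y > 0}\<^sup>+ \<longrightarrow> (t, r) \<in> {(x, y). M x y > 0}\<^sup>+)"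

definition is_leak :: "('q::finite, 'a) pa \<Rightarrow> (nat \<Rightarrow> 'a list) \<Rightarrow> bool" where
  "is_leak A u \<longleftrightarrow>
     (\<forall>n. idempotent_word A (u n)) \<and>
     (\<exists>M. (\<forall>s t. (\<lambda>n. word_mat A (u n) s t) \<longlonglongrightarrow> M s t) \<and> idempotent_mat M \<and>
       (\<exists>r q. mc_recurrent M r \<and> mc_recurrent M q \<and>
          (\<lambda>n. prob_path A r (u n) q) \<longlonglongrightarrow> 0 \<and>
          (\<forall>n. prob_path A r (u n) q > 0)))"

definition leaktight :: "('q::finite, 'a) pa \<Rightarrow> bool" where
  "leaktight A \<longleftrightarrow> \<not> (\<exists>u. is_leak A u)"

type_synonym 'q lword = "'q \<Rightarrow> 'q \<Rightarrow> bool"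

definition is_limit_word :: "'q lword \<Rightarrow> bool" where
  "is_limit_word w \<longleftrightarrow> (\<forall>s. \<exists>t. w s t)"

definition lw_mult :: "'q lword \<Rightarrow> 'q lword \<Rightarrow> 'q lword" where
  "lw_mult u v = (\<lambda>s t. \<exists>q. u s q \<and> v q t)"

definition lw_idempotent :: "'q lword \<Rightarrow> bool" where
  "lw_idempotent u \<longleftrightarrow> lw_mult u u = u"

definition lw_recurrent :: "'q lword \<Rightarrow> 'q \<Rightarrow> bool" where
  "lw_recurrent u s \<longleftrightarrow> (\<forall>t. u s t \<longrightarrow> u t s)"

definition lw_sharp :: "'q lword \<Rightarrow> 'q lword" where
  "lw_sharp u = (\<lambda>s t. u s t \<and> lw_recurrent u t)"

definition letter_lw :: "('q, 'a) pa \<Rightarrow> 'a \<Rightarrow> 'q lword" where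
  "letter_lw A a = (\<lambda>s t. pmf (trans A s a) t > 0)"

definition lw_one :: "'q lword" where
  "lw_one = (\<lambda>s t. s = t)"

inductive_set markov_monoid :: "('q, 'a) pa \<Rightarrow> 'q lword set" for A where
  letter: "letter_lw A a \<in> markov_monoid A"
| one: "lw_one \<in> markov_monoid A"
| concat: "u \<in> markov_monoid A \<Longrightarrow> v \<in> markov_monoid A \<Longrightarrow> lw_mult u v \<in> markov_monoid A"
| iter: "u \<in> markov_monoid A \<Longrightarrow> lw_idempotent u \<Longrightarrow> lw_sharp u \<in> markov_monoid A"

end

theory Submission
  imports Defs "HOL-Library.Sublist"
begin

text \<open>
  Besides a limit-word \<open>u\<close> one tracks the exact support \<open>u\<^sub>+\<close> of the words that realise it; iteration
  turns \<open>(u, u\<^sub>+)\<close> into \<open>(u\<^sup>\<sharp>, u\<^sub>+)\<close>. Every pair generated in this way is the limit of actual words with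
  support \<open>u\<^sub>+\<close>, so in a leaktight automaton \<open>u\<^sub>+\<close> has no edge between different recurrent classes of an
  idempotent \<open>u\<close>. Consequently, if words \<open>w\<^sub>1, \<dots>, w\<^sub>m\<close> are all bounded below by \<open>c\<close> on such a \<open>u\<close>, their
  concatenation is bounded below by \<open>c\<^sup>2\<close> on \<open>u\<^sup>\<sharp>\<close>, independently of \<open>m\<close>. A variant of Simon's factorisation
  forest theorem, with iteration nodes labelled by \<open>e\<^sup>\<sharp>\<close>, evaluates every word by a tree of bounded height
  built from concatenations and iterations. Hence all words have a uniform lower bound on some element of
  the Markov monoid, and along a sequence of words one such element occurs infinitely often.
\<close>

subsection \<open>Stability in finite monoids\<close>

text \<open>
  The size of the two-sided principal ideal replaces the J-order: within a product it is constant
  exactly when the product stays in one J-class.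
\<close>

definition jrank :: "'g::{monoid_mult,finite} \<Rightarrow> nat" where
  "jrank g = card (range (\<lambda>(a, b). a * g * b))"

lemma jrank_pos: "0 < jrank g"
  unfolding jrank_def by (simp add: card_gt_0_iff)

lemma range_mult_right_subset: "range (\<lambda>(a, b). a * (g * h) * b) \<subseteq> range (\<lambda>(a, b). a * g * b)"
  for g h :: "'g::{monoid_mult,finite}"
proof (clarsimp)
  fix a b :: 'g
  show "a * (g * h) * b \<in> range (\<lambda>(a, b). a * g * b)"
    by (rule range_eqI[of _ _ "(a, h * b)"]) (simp add: mult.assoc)
qed

lemma range_mult_left_subset: "range (\<lambda>(a, b). a * (h * g) * b) \<subseteq> range (\<lambda>(a, b). a * g * b)"
  for g h :: "'g::{monoid_mult,finite}"
proof (clarsimp)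
  fix a b :: 'g
  show "a * (h * g) * b \<in> range (\<lambda>(a, b). a * g * b)"
    by (rule range_eqI[of _ _ "(a * h, b)"]) (simp add: mult.assoc)
qed

lemma jrank_mult_right: "jrank (g * h) \<le> jrank g"
  unfolding jrank_def by (intro card_mono range_mult_right_subset) simp

lemma jrank_mult_left: "jrank (h * g) \<le> jrank g"
  unfolding jrank_def by (intro card_mono range_mult_left_subset) simp

lemma power_repeats:
  fixes c :: "'g::{monoid_mult,finite}"
  obtains i d where "c ^ (i + Suc d) = c ^ i"
proof -
  have "\<not> inj (\<lambda>n. c ^ n)"
    using finite_imageD[of "\<lambda>n. c ^ n" UNIV] by auto
  then obtain m n where mn: "m < n" "c ^ m = c ^ n"
    unfolding inj_def by (metis linorder_neqE_nat)
  then obtain d where "n = m + Suc d"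
    using less_iff_Suc_add by auto
  with mn show ?thesis
    by (intro that[of m d]) simp
qed

text \<open>Stability: inclusion and equal size make the two ideals coincide, so
  \<open>g = a * g * (h * b)\<close> for some \<open>a\<close>, \<open>b\<close>. Iterating this,
  and using that the powers of \<open>h * b\<close> eventually repeat, absorbs the left factor
  \<open>a\<close>.\<close>

lemma jrank_mult_right_eqD:
  fixes g h :: "'g::{monoid_mult,finite}"
  assumes "jrank (g * h) = jrank g"
  shows "\<exists>b. g = g * h * b"
proof -
  have "range (\<lambda>(a, b). a * (g * h) * b) = range (\<lambda>(a, b). a * g * b)"
    using assms unfolding jrank_def
    by (intro card_subset_eq range_mult_right_subset) simp_all
  moreover have "g \<in> range (\<lambda>(a, b). a * g * b)"
    by (rule range_eqI[of _ _ "(1, 1)"]) simp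
  ultimately have "g \<in> range (\<lambda>(a, b). a * (g * h) * b)" by simp
  then obtain a b where "g = a * (g * h) * b" by auto
  then have g: "g = a * g * (h * b)" by (simp add: mult.assoc)
  have pow: "g = a ^ n * g * (h * b) ^ n" for n
  proof (induction n)
    case (Suc n)
    have "g = a ^ n * (a * g * (h * b)) * (h * b) ^ n" using Suc g by simp
    also have "\<dots> = a ^ Suc n * g * (h * b) ^ Suc n"
      by (simp only: power_Suc2[of a] power_Suc[of "h * b"] mult.assoc)
    finally show ?case .
  qed simp
  obtain i d where "(h * b) ^ (i + Suc d) = (h * b) ^ i" by (rule power_repeats)
  then have rep: "(h * b) ^ i * (h * b) ^ Suc d = (h * b) ^ i" by (simp only: power_add[symmetric])
  have "g * (h * b) ^ Suc d = a ^ i * g * (h * b) ^ i * (h * b) ^ Suc d"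
    using pow[of i] by (rule arg_cong[where f = "\<lambda>x. x * (h * b) ^ Suc d"])
  also have "\<dots> = a ^ i * g * (h * b) ^ i" by (simp only: rep mult.assoc)
  also have "\<dots> = g" by (rule pow[symmetric])
  finally have "g = g * h * (b * (h * b) ^ d)" by (simp add: mult.assoc)
  then show ?thesis ..
qed

text \<open>The left-right dual: here the powers of \<open>a * h\<close> repeat and the right factor
  \<open>b\<close> is absorbed.\<close>

lemma jrank_mult_left_eqD:
  fixes g h :: "'g::{monoid_mult,finite}"
  assumes "jrank (h * g) = jrank g"
  shows "\<exists>b. g = b * (h * g)"
proof -
  have "range (\<lambda>(a, b). a * (h * g) * b) = range (\<lambda>(a, b). a * g * b)"
    using assms unfolding jrank_def
    by (intro card_subset_eq range_mult_left_subset) simp_all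
  moreover have "g \<in> range (\<lambda>(a, b). a * g * b)"
    by (rule range_eqI[of _ _ "(1, 1)"]) simp
  ultimately have "g \<in> range (\<lambda>(a, b). a * (h * g) * b)" by simp
  then obtain a b where "g = a * (h * g) * b" by auto
  then have g: "g = (a * h) * g * b" by (simp add: mult.assoc)
  have pow: "g = (a * h) ^ n * g * b ^ n" for n
  proof (induction n)
    case (Suc n)
    have "g = (a * h) ^ n * ((a * h) * g * b) * b ^ n" using Suc g by simp
    also have "\<dots> = (a * h) ^ Suc n * g * b ^ Suc n"
      by (simp only: power_Suc2[of "a * h"] power_Suc[of b] mult.assoc)
    finally show ?case .
  qed simp
  obtain i d where "(a * h) ^ (i + Suc d) = (a * h) ^ i" by (rule power_repeats)
  then have rep: "(a * h) ^ Suc d * (a * h) ^ i = (a * h) ^ i"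
    by (simp only: power_add[symmetric] add.commute)
  have "(a * h) ^ Suc d * g = (a * h) ^ Suc d * ((a * h) ^ i * g * b ^ i)"
    using pow[of i] by (rule arg_cong[where f = "\<lambda>x. (a * h) ^ Suc d * x"])
  also have "\<dots> = (a * h) ^ i * g * b ^ i" by (simp only: rep mult.assoc[symmetric])
  also have "\<dots> = g" by (rule pow[symmetric])
  finally have "g = (a * h) ^ d * a * (h * g)" by (simp only: power_Suc2 mult.assoc)
  then show ?thesis ..
qed

text \<open>Equal rank and \<open>p * y = p\<close> put \<open>y\<close> in the left ideal of
  \<open>p\<close>, so whatever fixes \<open>p\<close> from the right fixes \<open>y\<close> too.
  With \<open>y' = y\<close> this makes \<open>y\<close> idempotent.\<close>

lemma loop_absorb:
  fixes p y y' :: "'g::{monoid_mult,finite}"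
  assumes "jrank p = jrank y" "p * y = p" "p * y' = p"
  shows "y * y' = y"
proof -
  obtain z where "y = z * p"
    using jrank_mult_left_eqD[of p y] assms(1,2) by auto
  then show ?thesis using assms(3) by (simp add: mult.assoc)
qed

text \<open>By stability \<open>x * d\<close> lies in the right ideal of the idempotent
  \<open>x * c\<close>, so the product of \<open>x * c\<close> and \<open>x * d\<close> is
  \<open>x * d\<close>; by absorption at \<open>p\<close> the same product is
  \<open>x * c\<close>.\<close>

lemma loop_unique:
  fixes p x :: "'g::{monoid_mult,finite}"
  assumes "jrank p = k" "jrank x = k" "jrank (x * c) = k" "jrank (x * d) = k"
    and "p * (x * c) = p" "p * (x * d) = p"
  shows "x * c = x * d"
proof -
  obtain b where "x = x * c * b"
    using jrank_mult_right_eqD[of x c] assms(2,3) by auto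
  then have "x * d = x * c * (b * d)" by (metis mult.assoc)
  moreover have "x * c * (x * c) = x * c" using loop_absorb[of p "x * c" "x * c"] assms by simp
  ultimately have "x * c * (x * d) = x * d" by (metis mult.assoc)
  moreover have "x * c * (x * d) = x * c" using loop_absorb[of p "x * c" "x * d"] assms by simp
  ultimately show ?thesis by simp
qed

subsection \<open>Factorisation trees of bounded height\<close>

fun colours :: "'g::monoid_mult \<Rightarrow> 'g list \<Rightarrow> ('g \<times> 'g) set" where
  "colours p [] = {}"
| "colours p (x # xs) = insert (p, x) (colours (p * x) xs)"

lemma colours_append: "colours p (xs @ ys) = colours p xs \<union> colours (p * prod_list xs) ys"
  by (induction xs arbitrary: p) (auto simp: mult.assoc)

text \<open>A factor of a word with one value chosen for it; lists of items act as words over a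
  coarser alphabet.\<close>

type_synonym ('w, 'g) item = "'w list \<times> 'g"

abbreviation word_of :: "('w, 'g) item list \<Rightarrow> 'w list" where
  "word_of bs \<equiv> concat (map fst bs)"

abbreviation value_of :: "('w, 'g::monoid_mult) item list \<Rightarrow> 'g" where
  "value_of bs \<equiv> prod_list (map snd bs)"

lemma word_of_concat: "word_of (concat bss) = concat (map word_of bss)"
  by (induction bss) simp_all

lemma first_occurrence:
  assumes "(r, x) \<in> colours p (map snd bs)"
  obtains ys b zs where "bs = ys @ b # zs" "snd b = x" "p * value_of ys = r" "(r, x) \<notin> colours p (map snd ys)"
proof -
  have "\<exists>ys b zs. bs = ys @ b # zs \<and> snd b = x \<and> p * value_of ys = r \<and> (r, x) \<notin> colours p (map snd ys)"
    using assms
  proof (induction bs arbitrary: p)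
    case (Cons b bs)
    show ?case
    proof (cases "(r, x) = (p, snd b)")
      case True
      then show ?thesis by (intro exI[of _ "[]"]) auto
    next
      case False
      with Cons.prems have "(r, x) \<in> colours (p * snd b) (map snd bs)" by auto
      from Cons.IH[OF this] obtain ys c zs where
        "bs = ys @ c # zs" "snd c = x" "p * snd b * value_of ys = r" "(r, x) \<notin> colours (p * snd b) (map snd ys)"
        by auto
      with False show ?thesis
        by (intro exI[of _ "b # ys"] exI[of _ c] exI[of _ zs]) (auto simp: mult.assoc)
    qed
  qed simp
  then show ?thesis using that by auto
qed

text \<open>
  \<open>E n w g\<close> reads: some tree of height at most \<open>n\<close> over \<open>w\<close> evaluates to \<open>g\<close>. A word may have several
  values, since \<open>sharp e\<close> can differ from \<open>e\<close>.
\<close>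

locale factorisation =
  fixes E :: "nat \<Rightarrow> 'w list \<Rightarrow> 'g::{monoid_mult,finite} \<Rightarrow> bool"
    and sharp :: "'g \<Rightarrow> 'g"
  assumes mono: "E n w g \<Longrightarrow> n \<le> m \<Longrightarrow> E m w g"
    and one: "E n [] 1"
    and mult: "E n v g \<Longrightarrow> E n w h \<Longrightarrow> E (Suc n) (v @ w) (g * h)"
    and iter: "e * e = e \<Longrightarrow> vs \<noteq> [] \<Longrightarrow> (\<And>v. v \<in> set vs \<Longrightarrow> E n v e) \<Longrightarrow> E (Suc n) (concat vs) (sharp e)"
    and mult_sharp: "E n w e \<Longrightarrow> e * e = e \<Longrightarrow> e * sharp e = sharp e"
    and sharp_mult: "E n w e \<Longrightarrow> e * e = e \<Longrightarrow> sharp e * e = sharp e"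
    and sharp_sharp: "E n w e \<Longrightarrow> e * e = e \<Longrightarrow> sharp e * sharp e = sharp e"
begin

abbreviation items :: "nat \<Rightarrow> ('w, 'g) item list \<Rightarrow> bool" where
  "items n bs \<equiv> \<forall>b\<in>set bs. E n (fst b) (snd b)"

text \<open>This concerns every value that trees of height at most \<open>h\<close> can reach,
  including those obtained through \<open>sharp\<close>, whereas \<open>smooth\<close> concerns the
  plain product only.\<close>

definition steady :: "nat \<Rightarrow> nat \<Rightarrow> ('w, 'g) item list \<Rightarrow> bool" where
  "steady k h bs \<longleftrightarrow> (\<forall>ys g. sublist ys bs \<longrightarrow> ys \<noteq> [] \<longrightarrow> E h (word_of ys) g \<longrightarrow> k \<le> jrank g)"

definition smooth :: "nat \<Rightarrow> ('w, 'g) item list \<Rightarrow> bool" where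
  "smooth k bs \<longleftrightarrow> (\<forall>ys. sublist ys bs \<longrightarrow> ys \<noteq> [] \<longrightarrow> jrank (value_of ys) = k)"

lemma steady_sublist: "steady k h bs \<Longrightarrow> sublist ys bs \<Longrightarrow> steady k h ys"
  unfolding steady_def by (meson sublist_order.order_trans)

lemma smooth_sublist: "smooth k bs \<Longrightarrow> sublist ys bs \<Longrightarrow> smooth k ys"
  unfolding smooth_def by (meson sublist_order.order_trans)

lemma items_sublist: "items n bs \<Longrightarrow> sublist ys bs \<Longrightarrow> items n ys"
  by (meson set_mono_sublist subsetD)

text \<open>\<open>sharp e\<close> lies in the right ideal of \<open>e\<close>. Without a drop of
  rank, stability gives \<open>e = sharp e * b\<close>, so the idempotent \<open>sharp e\<close> is
  a left identity for \<open>e\<close>; but \<open>sharp e * e\<close> also equals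
  \<open>sharp e\<close>.\<close>

lemma sharp_eq_self:
  assumes "E n w e" "e * e = e" "jrank e \<le> jrank (sharp e)"
  shows "sharp e = e"
proof -
  have es: "e * sharp e = sharp e" and ss: "sharp e * sharp e = sharp e"
    using mult_sharp sharp_sharp assms by blast+
  have "jrank (sharp e) \<le> jrank e" using jrank_mult_right[of e "sharp e"] es by simp
  then obtain b where "e = e * sharp e * b"
    using jrank_mult_right_eqD[of e "sharp e"] es assms(3) by auto
  then have "e = sharp e * b" using es by simp
  then have "sharp e * e = e" using ss by (metis mult.assoc)
  then show ?thesis using sharp_mult assms by metis
qed

text \<open>
  The colour of a cut is the pair of the prefix product and the next value. Factors between cuts of the
  same colour all have the same idempotent value \<open>e\<close>, and steadiness forces \<open>sharp e = e\<close>; cutting at all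
  occurrences of the first colour leaves pieces with one colour less.
\<close>

lemma colour_eval:
  assumes "n + 3 * m \<le> h" "finite X" "card X = m" "colours p (map snd bs) \<subseteq> X"
    and "jrank p = k" "jrank (p * value_of bs) = k"
    and "smooth k bs" "steady k h bs" "items n bs"
  shows "E (n + 3 * m) (word_of bs) (value_of bs)"
  using assms
proof (induction m arbitrary: X p bs)
  case 0
  then have "bs = []" by (cases bs) auto
  then show ?case using mono[OF one, of 0] by simp
next
  case (Suc m)
  define f where "f = n + 3 * m"
  show ?case
  proof (cases bs)
    case Nil
    then show ?thesis using mono[OF one, of 0] by simp
  next
    case (Cons b bs')
    define x where "x = snd b"
    have x: "(p, x) \<in> X" using Suc.prems Cons by (auto simp: x_def)
    \<comment> \<open>A piece that starts with \<open>x\<close> and does not meet the colour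
      \<open>(p, x)\<close> again: its remainder has prefix \<open>p * x\<close> and one colour
      less, so the outer induction applies.\<close>
    have step: "E (Suc f) (word_of (c # y)) (x * value_of y) \<and> jrank x = k"
      if "snd c = x" "sublist (c # y) bs" "colours (p * x) (map snd y) \<subseteq> X - {(p, x)}"
        "jrank (p * (x * value_of y)) = k" for c y
    proof -
      have sm: "smooth k (c # y)" by (rule smooth_sublist[OF Suc.prems(7) that(2)])
      have sub: "sublist y bs"
        by (rule sublist_order.order_trans[OF _ that(2)]) (simp add: sublist_Cons_right)
      have kx: "jrank x = k"
        using sm[unfolded smooth_def, rule_format, of "[c]"] that(1) by (simp add: sublist_Cons_right)
      have "jrank (p * x) \<le> jrank p" "jrank (p * x * value_of y) \<le> jrank (p * x)"
        by (rule jrank_mult_right)+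
      then have kpx: "jrank (p * x) = k" "jrank (p * x * value_of y) = k"
        using that(4) Suc.prems(5) by (simp_all add: mult.assoc)
      have "E f (word_of y) (value_of y)"
        unfolding f_def
        by (rule Suc.IH[OF _ _ _ that(3) kpx])
          (use Suc.prems(1,2,3) x smooth_sublist[OF Suc.prems(7) sub] steady_sublist[OF Suc.prems(8) sub]
            items_sublist[OF Suc.prems(9) sub] in auto)
      moreover have "E f (fst c) x"
      proof -
        have "c \<in> set bs" using that(2) by (meson list.set_intros(1) set_mono_sublist subsetD)
        then show ?thesis using mono Suc.prems(9) that(1) by (fastforce simp: f_def)
      qed
      ultimately show ?thesis using mult kx by simp
    qed
    \<comment> \<open>Each list in \<open>Ys\<close> runs from one cut of colour
      \<open>(p, x)\<close> to the next and is therefore a loop at \<open>p\<close>;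
      \<open>z\<close> starts at the last such cut.\<close>
    have split: "\<exists>Ys z. v = concat Ys @ z \<and> z \<noteq> [] \<and> E (Suc f) (word_of z) (value_of z) \<and>
        (\<forall>y\<in>set Ys. y \<noteq> [] \<and> E (Suc f) (word_of y) (value_of y) \<and> p * value_of y = p \<and> (\<exists>d. value_of y = x * d))"
      if "v = c # v'" "snd c = x" "sublist v bs" "colours p (map snd v) \<subseteq> X" "jrank (p * value_of v) = k"
      for v c v'
      using that
    proof (induction "length v" arbitrary: v c v' rule: less_induct)
      case less
      show ?case
      proof (cases "(p, x) \<in> colours (p * x) (map snd v')")
        case False
        then have "E (Suc f) (word_of v) (value_of v)"
          using step[of c v'] less.prems by auto
        then show ?thesis using less.prems by (intro exI[of _ "[]"] exI[of _ v]) auto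
      next
        case True
        then obtain y c' z where
          v': "v' = y @ c' # z" "snd c' = x" "p * x * value_of y = p" "(p, x) \<notin> colours (p * x) (map snd y)"
          by (rule first_occurrence)
        have v: "v = (c # y) @ (c' # z)" using v' less.prems by simp
        have sub: "sublist (c # y) bs" "sublist (c' # z) bs"
          using less.prems(3) unfolding v
          by (meson sublist_append_rightI sublist_append_leftI sublist_order.order_trans)+
        have vy: "p * (x * value_of y) = p" using v'(3) by (simp add: mult.assoc)
        have col: "colours (p * x) (map snd y) \<subseteq> X - {(p, x)}" "colours p (map snd (c' # z)) \<subseteq> X"
          using less.prems(2,4) v' vy unfolding v by (auto simp: colours_append mult.assoc)
        have "p * value_of v = p * value_of (c' # z)"
          using less.prems(2) v'(3) unfolding v by (simp add: mult.assoc[symmetric])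
        then have "jrank (p * value_of (c' # z)) = k" using less.prems(5) by simp
        with less.hyps[OF _ refl v'(2) sub(2) col(2)] v obtain Ys w where
          w: "c' # z = concat Ys @ w" "w \<noteq> []" "E (Suc f) (word_of w) (value_of w)"
          "\<forall>y\<in>set Ys. y \<noteq> [] \<and> E (Suc f) (word_of y) (value_of y) \<and> p * value_of y = p \<and> (\<exists>d. value_of y = x * d)"
          by auto
        have "E (Suc f) (word_of (c # y)) (x * value_of y)"
          using step[OF less.prems(2) sub(1) col(1)] vy Suc.prems(5) by simp
        then show ?thesis
          using w less.prems(2) vy unfolding v
          by (intro exI[of _ "(c # y) # Ys"] exI[of _ w]) auto
      qed
    qed
    obtain Ys z where Ys: "bs = concat Ys @ z" "E (Suc f) (word_of z) (value_of z)"
      "\<And>y. y \<in> set Ys \<Longrightarrow> y \<noteq> [] \<and> E (Suc f) (word_of y) (value_of y) \<and> p * value_of y = p \<and> (\<exists>d. value_of y = x * d)"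
      using split[OF Cons] Suc.prems(4,6) x_def by (metis sublist_order.order_refl)
    show ?thesis
    proof (cases Ys)
      case Nil
      then show ?thesis using mono[OF Ys(2)] Ys(1) by (simp add: f_def)
    next
      case (Cons y0 Ys')
      define e where "e = value_of y0"
      have rk: "jrank (value_of y) = k" if "y \<in> set Ys" for y
      proof -
        obtain As Bs where "Ys = As @ y # Bs" using \<open>y \<in> set Ys\<close> by (meson split_list)
        then have "bs = concat As @ y @ concat Bs @ z" using Ys(1) by simp
        then have "sublist y bs" by (auto simp: sublist_def)
        then show ?thesis using Suc.prems(7) Ys(3)[OF that] unfolding smooth_def by blast
      qed
      have kx: "jrank x = k"
        using Suc.prems(7)[unfolded smooth_def, rule_format, of "[b]"] \<open>bs = b # bs'\<close>
        by (simp add: x_def sublist_Cons_right)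
      have y0: "y0 \<in> set Ys" using Cons by simp
      have e: "value_of y = e" if "y \<in> set Ys" for y
        using loop_unique[of p k x] Suc.prems(5) kx rk[OF that] rk[OF y0] Ys(3)[OF that] Ys(3)[OF y0]
        unfolding e_def by metis
      have idem: "e * e = e"
        using loop_absorb[of p e e] rk[OF y0] Ys(3)[OF y0] Suc.prems(5) by (simp add: e_def)
      have "E (Suc (Suc f)) (concat (map word_of Ys)) (sharp e)"
        using idem y0 Ys(3) e by (intro iter) auto
      then have Ee: "E (Suc (Suc f)) (word_of (concat Ys)) (sharp e)"
        by (simp only: word_of_concat)
      then have "E h (word_of (concat Ys)) (sharp e)"
        by (rule mono) (use Suc.prems(1) in \<open>simp add: f_def\<close>)
      moreover have "sublist (concat Ys) bs" "concat Ys \<noteq> []"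
        using Ys(1) Ys(3)[OF y0] y0 by auto
      ultimately have "k \<le> jrank (sharp e)"
        using Suc.prems(8) unfolding steady_def by blast
      then have "sharp e = e"
        using sharp_eq_self[OF _ idem] Ys(3)[OF y0] rk[OF y0] by (metis e_def)
      moreover
      have "value_of (concat Zs) = e" if "set Zs \<subseteq> set Ys" "Zs \<noteq> []" for Zs
        using that(2,1)
      proof (induction Zs rule: list_nonempty_induct)
        case (single x)
        then show ?case using e by simp
      next
        case (cons x xs)
        then show ?case using e idem by simp
      qed
      from this[of Ys] have "value_of (concat Ys) = e" using Cons by simp
      ultimately have "E (Suc (Suc f)) (word_of (concat Ys)) (value_of (concat Ys))"
        using Ee by (simp only:)
      \<comment> \<open>Three levels per colour: one joins the first item of a piece to its
        remainder, one iterates over all loops, one appends \<open>z\<close>.\<close>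
      from mono[OF mult[OF this mono[OF Ys(2)]], of "n + 3 * Suc m"] show ?thesis
        unfolding Ys(1) f_def by simp
    qed
  qed
qed

text \<open>Putting one item before a tail evaluated by induction costs height \<open>Suc h\<close>,
  where steadiness still bounds the rank below by \<open>k\<close>; the first item bounds it above.
  The resulting smoothness feeds \<open>colour_eval\<close>, which evaluates afresh within
  \<open>h\<close>, so the height does not grow with the length.\<close>

lemma steady_eval:
  assumes h: "h = Suc (n + 3 * CARD('g \<times> 'g))"
    and "\<forall>b\<in>set bs. E n (fst b) (snd b) \<and> jrank (snd b) \<le> k" "steady k (Suc h) bs"
  shows "smooth k bs \<and> E h (word_of bs) (value_of bs)"
  using assms(2,3)
proof (induction "length bs" arbitrary: bs rule: less_induct)
  case less
  show ?case
  proof (cases bs)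
    case Nil
    then show ?thesis using mono[OF one, of 0] by (simp add: smooth_def)
  next
    case (Cons b bs')
    have IH: "smooth k ys \<and> E h (word_of ys) (value_of ys)" if "sublist ys bs" "ys \<noteq> bs" for ys
    proof (rule less.hyps)
      show "length ys < length bs"
        using that by (auto simp: sublist_def)
    qed (use that less.prems items_sublist steady_sublist set_mono_sublist in \<open>blast+\<close>)
    have bs': "E h (word_of bs') (value_of bs')" "smooth k bs'"
      using IH[of bs'] Cons by (auto simp: sublist_Cons_right)
    have b: "E n (fst b) (snd b)" "jrank (snd b) \<le> k" using less.prems(1) Cons by auto
    have "E (Suc h) (fst b @ word_of bs') (snd b * value_of bs')"
      using mult[OF mono[OF b(1)] bs'(1)] h by simp
    then have "k \<le> jrank (value_of bs)"
      using less.prems(2) Cons unfolding steady_def by (metis concat.simps(2) list.map(2) list.distinct(1) prod_list.Cons sublist_order.order_refl)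
    moreover have "jrank (value_of bs) \<le> jrank (snd b)" using jrank_mult_right Cons by simp
    ultimately have kb: "jrank (value_of bs) = k" "jrank (snd b) = k" using b(2) by auto
    then have sm: "smooth k bs"
      using IH unfolding smooth_def by (metis sublist_order.order_refl)
    \<comment> \<open>The first item serves as the prefix, since \<open>colour_eval\<close> asks for
      a prefix of rank \<open>k\<close> and the unit need not have that rank.\<close>
    have "E (n + 3 * CARD('g \<times> 'g)) (word_of bs') (value_of bs')"
    proof (rule colour_eval[where p = "snd b" and k = k and h = "Suc h" and X = UNIV])
      show "steady k (Suc h) bs'"
        using less.prems(2) steady_sublist Cons by (metis sublist_Cons_right sublist_order.order_refl)
    qed (use kb bs' Cons less.prems(1) h in auto)
    from mult[OF mono[OF b(1)] this] show ?thesis using sm Cons h by simp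
  qed
qed

text \<open>
  Whenever a steady list ceases to be steady, some suffix drops below level \<open>k\<close>; multiplying by the steady
  rest on its left closes off a block of smaller rank.
\<close>

lemma reduce:
  assumes h: "h = Suc (n + 3 * CARD('g \<times> 'g))"
    and "\<forall>b\<in>set bs. E n (fst b) (snd b) \<and> jrank (snd b) \<le> k"
  shows "\<exists>cs tl. word_of bs = word_of cs @ word_of tl \<and> set tl \<subseteq> set bs \<and> steady k (Suc h) tl \<and>
    (\<forall>c\<in>set cs. E (Suc (Suc h)) (fst c) (snd c) \<and> jrank (snd c) < k)"
  using assms(2)
proof (induction bs rule: rev_induct)
  case Nil
  show ?case by (intro exI[of _ "[]"]) (simp add: steady_def)
next
  case (snoc b bs)
  then obtain cs tl where IH: "word_of bs = word_of cs @ word_of tl" "set tl \<subseteq> set bs" "steady k (Suc h) tl"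
    "\<forall>c\<in>set cs. E (Suc (Suc h)) (fst c) (snd c) \<and> jrank (snd c) < k"
    by auto
  show ?case
  proof (cases "steady k (Suc h) (tl @ [b])")
    case True
    with IH show ?thesis by (intro exI[of _ cs] exI[of _ "tl @ [b]"]) auto
  next
    case False
    then obtain ys g where ys: "sublist ys (tl @ [b])" "ys \<noteq> []" "E (Suc h) (word_of ys) g" "jrank g < k"
      unfolding steady_def by (auto simp: not_le)
    then have "\<not> sublist ys tl"
      using IH(3) unfolding steady_def by (meson not_le)
    with ys(1,2) obtain xs where xs: "tl @ [b] = xs @ ys"
      by (auto simp: sublist_snoc suffix_def)
    with ys(2) obtain zs where tl: "tl = xs @ zs"
      by (metis append_butlast_last_id append_same_eq butlast_append butlast_snoc)
    then have "E h (word_of xs) (value_of xs)"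
      using steady_eval[OF h, of xs k] IH(2) snoc.prems steady_sublist[OF IH(3), of xs] by auto
    from mult[OF mono[OF this] ys(3)] have "E (Suc (Suc h)) (word_of (xs @ ys)) (value_of xs * g)" by simp
    moreover have "jrank (value_of xs * g) < k" using jrank_mult_left ys(4) le_less_trans by blast
    ultimately show ?thesis
      using IH xs[symmetric]
      by (intro exI[of _ "cs @ [(word_of (xs @ ys), value_of xs * g)]"] exI[of _ "[]"]) (auto simp: steady_def)
  qed
qed

text \<open>Induction on the rank bound with \<open>n\<close> arbitrary: \<open>reduce\<close>
  leaves factors of smaller rank, built at a larger but fixed height, and a steady tail. The former
  fall to the induction hypothesis, the latter to \<open>steady_eval\<close>. Rank \<open>0\<close>
  admits only the empty list.\<close>

lemma bounded_eval_below:
  "\<exists>N. \<forall>bs. (\<forall>b\<in>set bs. E n (fst b) (snd b) \<and> jrank (snd b) \<le> k) \<longrightarrow> (\<exists>g. E N (word_of bs) g)"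
proof (induction k arbitrary: n)
  case 0
  have "bs = []" if "\<forall>b\<in>set bs. E n (fst b) (snd b) \<and> jrank (snd b) \<le> 0" for bs
    using that by (cases bs) (auto simp: gr_implies_not0[OF jrank_pos])
  then show ?case using one by (metis concat.simps(1) list.map(1))
next
  case (Suc k)
  define h where "h = Suc (n + 3 * CARD('g \<times> 'g))"
  from Suc[of "Suc (Suc h)"] obtain N where
    N: "\<And>bs. (\<forall>b\<in>set bs. E (Suc (Suc h)) (fst b) (snd b) \<and> jrank (snd b) \<le> k) \<Longrightarrow> \<exists>g. E N (word_of bs) g"
    by blast
  have "\<exists>g. E (Suc (max N h)) (word_of bs) g"
    if bs: "\<forall>b\<in>set bs. E n (fst b) (snd b) \<and> jrank (snd b) \<le> Suc k" for bs
  proof -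
    from reduce[OF h_def bs] obtain cs tl where
      red: "word_of bs = word_of cs @ word_of tl" "set tl \<subseteq> set bs" "steady (Suc k) (Suc h) tl"
      "\<forall>c\<in>set cs. E (Suc (Suc h)) (fst c) (snd c) \<and> jrank (snd c) < Suc k"
      by blast
    obtain g where "E N (word_of cs) g" using N[of cs] red(4) by (auto simp: less_Suc_eq_le)
    moreover have "E h (word_of tl) (value_of tl)"
      using steady_eval[OF h_def _ red(3)] bs red(2) by blast
    ultimately show ?thesis
      unfolding red(1) by (blast intro: mult mono max.cobounded1 max.cobounded2)
  qed
  then show ?case by blast
qed

lemma bounded_eval:
  assumes "\<And>a. \<exists>g. E n [a] g"
  shows "\<exists>N. \<forall>w. \<exists>g. E N w g"
proof -
  obtain g where g: "\<And>a. E n [a] (g a)" using assms by metis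
  obtain N where N: "\<And>bs. (\<forall>b\<in>set bs. E n (fst b) (snd b) \<and> jrank (snd b) \<le> Max (range (jrank :: 'g \<Rightarrow> nat)))
      \<Longrightarrow> \<exists>g. E N (word_of bs) g"
    using bounded_eval_below by meson
  have "\<exists>g. E N w g" for w
    using N[of "map (\<lambda>a. ([a], g a)) w"] g by (auto simp: o_def)
  then show ?thesis by blast
qed

end

subsection \<open>Stochastic matrices and limit-words\<close>

definition stochastic :: "'q::finite mat \<Rightarrow> bool" where
  "stochastic M \<longleftrightarrow> (\<forall>s t. 0 \<le> M s t) \<and> (\<forall>s. (\<Sum>t\<in>UNIV. M s t) = 1)"

abbreviation supp :: "'q mat \<Rightarrow> 'q lword" where
  "supp M \<equiv> (\<lambda>s t. 0 < M s t)"

text \<open>Products of arbitrary matrices, because powers of a limit of word matrices need not be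
  word matrices.\<close>

definition mats :: "'q::finite mat list \<Rightarrow> 'q mat" where
  "mats Bs = foldr mat_mult Bs mat_one"

lemma mats_simps [simp]: "mats [] = mat_one" "mats (B # Bs) = mat_mult B (mats Bs)"
  by (simp_all add: mats_def)

lemma mat_mult_assoc: "mat_mult (mat_mult L M) N = mat_mult L (mat_mult M N)"
proof (intro ext)
  fix s t
  have "mat_mult (mat_mult L M) N s t = (\<Sum>q\<in>UNIV. \<Sum>r\<in>UNIV. L s r * M r q * N q t)"
    by (simp add: mat_mult_def sum_distrib_right)
  also have "\<dots> = (\<Sum>r\<in>UNIV. \<Sum>q\<in>UNIV. L s r * M r q * N q t)"
    by (rule sum.swap)
  also have "\<dots> = mat_mult L (mat_mult M N) s t"
    by (simp add: mat_mult_def sum_distrib_left mult.assoc)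
  finally show "mat_mult (mat_mult L M) N s t = mat_mult L (mat_mult M N) s t" .
qed

lemma mat_one_left [simp]: "mat_mult mat_one M = M"
proof (intro ext)
  fix s t
  have "(\<Sum>q\<in>UNIV. mat_one s q * M q t) = (\<Sum>q\<in>UNIV. if s = q then M q t else 0)"
    by (rule sum.cong) (simp_all add: mat_one_def)
  then show "mat_mult mat_one M s t = M s t" by (simp add: mat_mult_def)
qed

lemma mat_one_right [simp]: "mat_mult M mat_one = M"
proof (intro ext)
  fix s t
  have "(\<Sum>q\<in>UNIV. M s q * mat_one q t) = (\<Sum>q\<in>UNIV. if t = q then M s q else 0)"
    by (rule sum.cong) (simp_all add: mat_one_def)
  then show "mat_mult M mat_one s t = M s t" by (simp add: mat_mult_def)
qed

lemma word_mat_append: "word_mat A (u @ v) = mat_mult (word_mat A u) (word_mat A v)"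
  by (induction u) (simp_all add: mat_mult_assoc)

lemma word_mat_concat: "word_mat A (concat ws) = mats (map (word_mat A) ws)"
  by (induction ws) (simp_all add: word_mat_append)

lemma stochastic_one: "stochastic mat_one"
  by (simp add: stochastic_def mat_one_def)

lemma stochastic_mult:
  assumes "stochastic M" "stochastic N"
  shows "stochastic (mat_mult M N)"
proof -
  have "(\<Sum>t\<in>UNIV. mat_mult M N s t) = 1" for s
  proof -
    have "(\<Sum>t\<in>UNIV. mat_mult M N s t) = (\<Sum>q\<in>UNIV. \<Sum>t\<in>UNIV. M s q * N q t)"
      unfolding mat_mult_def by (rule sum.swap)
    also have "\<dots> = 1" using assms by (simp add: stochastic_def flip: sum_distrib_left)
    finally show ?thesis .
  qed
  then show ?thesis using assms by (auto simp: stochastic_def mat_mult_def intro!: sum_nonneg)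
qed

lemma stochastic_mats: "(\<And>B. B \<in> set Bs \<Longrightarrow> stochastic B) \<Longrightarrow> stochastic (mats Bs)"
  by (induction Bs) (auto intro: stochastic_one stochastic_mult)

lemma stochastic_letter: "stochastic (letter_mat A a)"
  by (auto simp: stochastic_def letter_mat_def intro: sum_pmf_eq_1)

lemma stochastic_word: "stochastic (word_mat A w)"
  by (induction w) (auto intro: stochastic_one stochastic_mult stochastic_letter)

lemma stochastic_nonneg: "stochastic M \<Longrightarrow> 0 \<le> M s t"
  by (simp add: stochastic_def)

lemma stochastic_le_one:
  assumes "stochastic M"
  shows "M s t \<le> 1"
proof -
  have "M s t \<le> (\<Sum>t\<in>UNIV. M s t)"
    using assms by (intro member_le_sum) (auto simp: stochastic_def)
  then show ?thesis using assms by (simp add: stochastic_def)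
qed

lemma stochastic_limit_word:
  assumes "stochastic M"
  shows "is_limit_word (supp M)"
  unfolding is_limit_word_def
proof
  fix s
  show "\<exists>t. 0 < M s t"
  proof (rule ccontr)
    assume "\<nexists>t. 0 < M s t"
    then have "(\<Sum>t\<in>UNIV. M s t) \<le> 0" by (intro sum_nonpos) (simp add: not_less)
    then show False using assms by (simp add: stochastic_def)
  qed
qed

lemma mat_mult_ge:
  assumes "stochastic M" "stochastic N"
  shows "M s q * N q t \<le> mat_mult M N s t"
  unfolding mat_mult_def
  by (rule member_le_sum) (use assms in \<open>auto simp: stochastic_def\<close>)

lemma supp_mult:
  assumes "stochastic M" "stochastic N"
  shows "supp (mat_mult M N) = lw_mult (supp M) (supp N)"
proof (intro ext iffI)
  fix s t
  assume "0 < mat_mult M N s t"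
  then have "mat_mult M N s t \<noteq> 0" by simp
  then obtain q where "M s q * N q t \<noteq> 0"
    unfolding mat_mult_def by (meson sum.not_neutral_contains_not_neutral)
  then show "lw_mult (supp M) (supp N) s t"
    using assms unfolding lw_mult_def stochastic_def by (intro exI[of _ q]) (auto simp: order.strict_iff_order)
next
  fix s t
  assume "lw_mult (supp M) (supp N) s t"
  then obtain q where "0 < M s q" "0 < N q t" by (auto simp: lw_mult_def)
  then have "0 < M s q * N q t" by simp
  then show "0 < mat_mult M N s t" using mat_mult_ge[OF assms] less_le_trans by blast
qed

lemma supp_one: "supp mat_one = lw_one"
  by (auto simp: mat_one_def lw_one_def)

lemma supp_mats_idempotent:
  assumes "lw_idempotent v" "Bs \<noteq> []" "\<And>B. B \<in> set Bs \<Longrightarrow> stochastic B \<and> supp B = v"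
  shows "supp (mats Bs) = v"
  using assms(2,3)
proof (induction Bs rule: list_nonempty_induct)
  case (single B)
  then show ?case by simp
next
  case (cons B Bs)
  then have "supp (mat_mult B (mats Bs)) = lw_mult v v"
    by (subst supp_mult) (auto intro: stochastic_mats)
  then show ?case using assms(1) by (simp add: lw_idempotent_def)
qed

lemma ex_positive_lower_bound:
  fixes f :: "'b::finite \<Rightarrow> real"
  shows "\<exists>c>0. c \<le> 1 \<and> (\<forall>x. 0 < f x \<longrightarrow> c \<le> f x)"
proof -
  \<comment> \<open>Adding \<open>1\<close> keeps the set nonempty and caps the minimum at
    \<open>1\<close>.\<close>
  let ?S = "insert 1 (f ` {x. 0 < f x})"
  have "Min ?S \<in> ?S" by (rule Min_in) auto
  then have "0 < Min ?S" by auto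
  moreover have "Min ?S \<le> 1" "\<forall>x. 0 < f x \<longrightarrow> Min ?S \<le> f x" by (auto intro: Min_le)
  ultimately show ?thesis by blast
qed

section \<open>Recurrence in idempotent limit-words\<close>

lemma lw_idempotentD:
  assumes "lw_idempotent u" "u s q" "u q t"
  shows "u s t"
proof -
  have "lw_mult u u s t" using assms(2,3) by (auto simp: lw_mult_def)
  then show ?thesis using assms(1) by (simp add: lw_idempotent_def)
qed

text \<open>Take a successor \<open>t\<close> of \<open>s\<close> with fewest successors. By
  transitivity all successors of \<open>t\<close> have the same successor set as \<open>t\<close>,
  hence are recurrent; \<open>t\<close> itself may lack a loop, so the witness is a successor of
  \<open>t\<close>.\<close>

lemma ex_recurrent:
  fixes u :: "'q::finite lword"
  assumes "lw_idempotent u" "is_limit_word u"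
  shows "\<exists>t. u s t \<and> lw_recurrent u t"
proof -
  obtain t0 where "u s t0" using assms(2) by (auto simp: is_limit_word_def)
  then obtain t where t: "u s t" and min: "\<And>q. u s q \<Longrightarrow> card {r. u t r} \<le> card {r. u q r}"
    using ex_has_least_nat[of "u s" t0 "\<lambda>q. card {r. u q r}"] by blast
  have same: "{r. u q r} = {r. u t r}" if "u t q" for q
    using min[OF lw_idempotentD[OF assms(1) t that]] lw_idempotentD[OF assms(1) that]
    by (intro card_seteq) auto
  obtain q where q: "u t q" using assms(2) by (auto simp: is_limit_word_def)
  have "u r q" if "u q r" for r
    using same[OF q] same[of r] that q by blast
  then have "lw_recurrent u q" by (simp add: lw_recurrent_def)
  then show ?thesis using lw_idempotentD[OF assms(1) t q] by blast
qed

lemma recurrent_refl: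
  assumes "lw_idempotent u" "is_limit_word u" "lw_recurrent u t"
  shows "u t t"
proof -
  obtain q where "u t q" using assms(2) by (auto simp: is_limit_word_def)
  then show ?thesis using assms(3) lw_idempotentD[OF assms(1)] by (auto simp: lw_recurrent_def)
qed

lemma recurrent_step:
  assumes "lw_idempotent u" "lw_recurrent u s" "u s t"
  shows "lw_recurrent u t"
  using assms(2,3) lw_idempotentD[OF assms(1)] unfolding lw_recurrent_def by blast

text \<open>Edges of \<open>lw_sharp u\<close> end in recurrent states, and these carry loops; the
  loop at the target supplies the missing factor in each equation.\<close>

lemma
  assumes "lw_idempotent u" "is_limit_word u"
  shows mult_lw_sharp: "lw_mult u (lw_sharp u) = lw_sharp u"
    and lw_sharp_mult: "lw_mult (lw_sharp u) u = lw_sharp u"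
    and lw_sharp_sharp: "lw_mult (lw_sharp u) (lw_sharp u) = lw_sharp u"
proof -
  have refl: "lw_sharp u t t" if "lw_sharp u s t" for s t
    using that recurrent_refl[OF assms] by (auto simp: lw_sharp_def)
  have step: "lw_sharp u s t" if "lw_sharp u s q" "u q t" for s q t
    using that lw_idempotentD[OF assms(1)] recurrent_step[OF assms(1)] unfolding lw_sharp_def by blast
  have pre: "lw_sharp u s t" if "u s q" "lw_sharp u q t" for s q t
    using that lw_idempotentD[OF assms(1)] unfolding lw_sharp_def by blast
  have sub: "u s t" if "lw_sharp u s t" for s t
    using that by (simp add: lw_sharp_def)
  show "lw_mult u (lw_sharp u) = lw_sharp u"
    unfolding fun_eq_iff lw_mult_def by (metis pre refl sub)
  show "lw_mult (lw_sharp u) u = lw_sharp u"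
    unfolding fun_eq_iff lw_mult_def by (metis step refl sub)
  show "lw_mult (lw_sharp u) (lw_sharp u) = lw_sharp u"
    unfolding fun_eq_iff lw_mult_def by (metis step refl sub)
qed

lemma is_limit_word_mult: "is_limit_word u \<Longrightarrow> is_limit_word v \<Longrightarrow> is_limit_word (lw_mult u v)"
  unfolding is_limit_word_def lw_mult_def by blast

lemma markov_monoid_limit_word:
  fixes A :: "('q::finite, 'a) pa"
  shows "w \<in> markov_monoid A \<Longrightarrow> is_limit_word w"
proof (induction rule: markov_monoid.induct)
  case (letter a)
  show ?case using stochastic_limit_word[OF stochastic_letter[of A a]]
    by (simp add: letter_lw_def letter_mat_def)
next
  case (iter u)
  then show ?case using ex_recurrent[of u] unfolding is_limit_word_def lw_sharp_def by blast
next
  case one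
  show ?case by (simp add: is_limit_word_def lw_one_def)
qed (rule is_limit_word_mult)

text \<open>The first matrix moves \<open>s\<close> to \<open>t\<close> with weight at least
  \<open>c\<close>. From then on only \<open>v\<close>-successors of \<open>t\<close> are visited,
  and from each of them the last matrix returns to \<open>t\<close> with weight at least
  \<open>c\<close>; the matrices in between merely average. Hence two factors \<open>c\<close>,
  whatever the length.\<close>

lemma mats_sharp_lower_bound:
  fixes u v :: "'q::finite lword"
  assumes u: "lw_idempotent u" "is_limit_word u" and v: "lw_idempotent v"
    and uv: "\<And>s t. u s t \<Longrightarrow> v s t"
    and no_leak: "\<And>r q. lw_recurrent u r \<Longrightarrow> lw_recurrent u q \<Longrightarrow> v r q \<Longrightarrow> u r q"
    and c: "0 < c" "c \<le> 1"
    and Bs: "Bs \<noteq> []" "\<And>B. B \<in> set Bs \<Longrightarrow> stochastic B"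
      "\<And>B s t. B \<in> set Bs \<Longrightarrow> 0 < B s t \<Longrightarrow> v s t" "\<And>B s t. B \<in> set Bs \<Longrightarrow> u s t \<Longrightarrow> c \<le> B s t"
    and st: "lw_sharp u s t"
  shows "c\<^sup>2 \<le> mats Bs s t"
proof -
  have ust: "u s t" and t: "lw_recurrent u t" using st by (auto simp: lw_sharp_def)
  have utt: "u t t" by (rule recurrent_refl[OF u t])
  \<comment> \<open>A state reachable from \<open>t\<close> in \<open>v\<close> leads in \<open>u\<close> to a recurrent state, which lies in the class of \<open>t\<close>.\<close>
  have home: "u q t" if "v t q" for q
  proof -
    obtain q' where q': "u q q'" "lw_recurrent u q'" using ex_recurrent[OF u] by blast
    have "v t q'" by (rule lw_idempotentD[OF v that uv[OF q'(1)]])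
    then have "u q' t" using no_leak[OF t q'(2)] t by (simp add: lw_recurrent_def)
    then show ?thesis by (rule lw_idempotentD[OF u(1) q'(1)])
  qed
  have return: "c \<le> mats Cs q t" if "Cs \<noteq> []" "set Cs \<subseteq> set Bs" "v t q" for Cs q
    using that
  proof (induction Cs arbitrary: q rule: list_nonempty_induct)
    case (single C)
    then show ?case using Bs(4) home by auto
  next
    case (cons C Cs)
    have C: "stochastic C" "\<And>s t. 0 < C s t \<Longrightarrow> v s t" using cons.prems Bs by auto
    have "C q r * c \<le> C q r * mats Cs r t" for r
    proof (cases "0 < C q r")
      case True
      then have "v t r" using lw_idempotentD[OF v cons.prems(2)] C by blast
      then show ?thesis using cons True by (intro mult_left_mono) auto
    next
      case False
      then show ?thesis using stochastic_nonneg[OF C(1), of q r] by simp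
    qed
    then have "(\<Sum>r\<in>UNIV. C q r * c) \<le> mats (C # Cs) q t"
      by (simp add: mat_mult_def sum_mono)
    then show ?case using C(1) by (simp add: stochastic_def flip: sum_distrib_right)
  qed
  obtain B Cs where B: "Bs = B # Cs" using Bs(1) by (cases Bs) auto
  have cB: "c \<le> B s t" using Bs(4) ust B by auto
  show ?thesis
  proof (cases "Cs = []")
    case True
    have "c\<^sup>2 \<le> c" using c by (simp add: power2_eq_square mult_left_le)
    then show ?thesis using cB B True by simp
  next
    case False
    then have "c \<le> mats Cs t t" using return[of Cs t] uv[OF utt] B by auto
    then have "c * c \<le> B s t * mats Cs t t" using cB c by (intro mult_mono) auto
    also have "\<dots> \<le> mats Bs s t"
      using mat_mult_ge[OF Bs(2)[of B] stochastic_mats[of Cs, OF Bs(2)]] B by simp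
    finally show ?thesis by (simp add: power2_eq_square)
  qed
qed

text \<open>Every state has an edge of weight at least \<open>c\<close> to a recurrent state, and
  recurrent states are never left, so the transient mass shrinks by the factor \<open>1 - c\<close>
  at each step. An edge absent from \<open>M\<close> is absent from all its positive powers.\<close>

lemma replicate_transient_tendsto:
  fixes M :: "'q::finite mat"
  assumes M: "stochastic M" and idem: "lw_idempotent (supp M)" and st: "\<not> lw_sharp (supp M) s t"
  shows "(\<lambda>k. mats (replicate (Suc k) M) s t) \<longlonglongrightarrow> 0"
proof -
  let ?R = "lw_recurrent (supp M)"
  have lim: "is_limit_word (supp M)" using stochastic_limit_word M by blast
  obtain c where c: "0 < c" "c \<le> 1" "\<And>s t. 0 < M s t \<Longrightarrow> c \<le> M s t"
    using ex_positive_lower_bound[of "\<lambda>(s, t). M s t"] by auto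
  have sto: "stochastic (mats (replicate k M))" for k by (rule stochastic_mats) (auto simp: M)
  \<comment> \<open>\<open>T k q\<close> is the mass on transient states after \<open>k\<close>
    steps from \<open>q\<close>.\<close>
  define T where "T k q = (\<Sum>t | \<not> ?R t. mats (replicate k M) q t)" for k q
  have T: "T k q \<le> (1 - c) ^ k \<and> (?R q \<longrightarrow> T k q = 0)" for k q
  proof (induction k arbitrary: q)
    case 0
    have "T 0 q = (\<Sum>t | \<not> ?R t. if q = t then 1 else 0)" by (simp add: T_def mat_one_def)
    then show ?case by simp
  next
    case (Suc k)
    have eq: "T (Suc k) q = (\<Sum>r\<in>UNIV. M q r * T k r)"
      unfolding T_def by (simp add: mat_mult_def sum_distrib_left) (rule sum.swap)
    obtain r where r: "0 < M q r" "?R r" using ex_recurrent[OF idem lim] by blast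
    have "T (Suc k) q = (\<Sum>r | \<not> ?R r. M q r * T k r)"
      unfolding eq using Suc by (intro sum.mono_neutral_right) auto
    also have "\<dots> \<le> (\<Sum>r | \<not> ?R r. M q r * (1 - c) ^ k)"
      using Suc M by (intro sum_mono mult_left_mono) (auto simp: stochastic_def)
    also have "\<dots> = (\<Sum>r | \<not> ?R r. M q r) * (1 - c) ^ k" by (simp add: sum_distrib_right)
    also have "\<dots> \<le> (1 - c) * (1 - c) ^ k"
    proof (rule mult_right_mono)
      have "c + (\<Sum>r | \<not> ?R r. M q r) \<le> (\<Sum>r\<in>insert r {r. \<not> ?R r}. M q r)"
        using r c(3) by simp
      also have "\<dots> \<le> (\<Sum>r\<in>UNIV. M q r)"
        using M by (intro sum_mono2) (auto simp: stochastic_def)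
      finally show "(\<Sum>r | \<not> ?R r. M q r) \<le> 1 - c" using M by (simp add: stochastic_def)
    qed (use c in simp)
    finally have "T (Suc k) q \<le> (1 - c) ^ Suc k" by simp
    moreover have "T (Suc k) q = 0" if "?R q"
      unfolding eq
    proof (rule sum.neutral, rule ballI)
      fix r
      show "M q r * T k r = 0"
      proof (cases "0 < M q r")
        case True
        then show ?thesis using recurrent_step[OF idem that] Suc by simp
      qed (use stochastic_nonneg[OF M, of q r] in simp)
    qed
    ultimately show ?case by simp
  qed
  show ?thesis
  proof (cases "0 < M s t")
    case False
    have "supp (mats (replicate (Suc k) M)) = supp M" for k
      by (rule supp_mats_idempotent[OF idem]) (use M in auto)
    then have "\<not> 0 < mats (replicate (Suc k) M) s t" for k using False by metis
    then have "mats (replicate (Suc k) M) s t = 0" for k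
      using stochastic_nonneg[OF sto, of "Suc k" s t] by (simp add: not_less order_antisym)
    then show ?thesis by simp
  next
    case True
    then have t: "\<not> ?R t" using st by (simp add: lw_sharp_def)
    have le: "mats (replicate k M) s t \<le> (1 - c) ^ k" for k
    proof -
      have "mats (replicate k M) s t \<le> T k s"
        unfolding T_def using t stochastic_nonneg[OF sto] by (intro member_le_sum) auto
      then show ?thesis using T[of k s] by linarith
    qed
    have "(\<lambda>k. (1 - c) ^ Suc k) \<longlonglongrightarrow> 0"
      using c by (intro LIMSEQ_Suc LIMSEQ_realpow_zero) auto
    show ?thesis
    proof (rule tendsto_sandwich[OF _ _ tendsto_const])
      show "(\<lambda>k. (1 - c) ^ Suc k) \<longlonglongrightarrow> 0" by fact
    qed (rule always_eventually, rule allI, rule stochastic_nonneg[OF sto] le)+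
  qed
qed

subsection \<open>The extended Markov monoid\<close>

text \<open>A type of its own, to be an instance of \<open>monoid_mult\<close>; it contains all
  pairs of relations, and \<open>extended_monoid\<close> singles out the generated ones.\<close>

datatype 'q elw = Elw (lower: "'q lword") (upper: "'q lword")

instantiation elw :: (type) monoid_mult
begin

definition "1 = Elw lw_one lw_one"
definition "x * y = Elw (lw_mult (lower x) (lower y)) (lw_mult (upper x) (upper y))"

instance
proof
  have assoc: "lw_mult (lw_mult a b) c = lw_mult a (lw_mult b c)" for a b c :: "'a lword"
    unfolding lw_mult_def by (intro ext) blast
  have one: "lw_mult lw_one a = a" "lw_mult a lw_one = a" for a :: "'a lword"
    unfolding lw_mult_def lw_one_def by simp_all
  fix x y z :: "'a elw"
  show "x * y * z = x * (y * z)" by (simp add: times_elw_def assoc)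
  show "1 * x = x" "x * 1 = x" by (simp_all add: times_elw_def one_elw_def one)
qed

end

instance elw :: (finite) finite
proof
  have "range (\<lambda>(a, b). Elw a b) = (UNIV :: 'a elw set)"
  proof (rule UNIV_eq_I[symmetric])
    fix x :: "'a elw"
    show "x \<in> range (\<lambda>(a, b). Elw a b)"
      by (rule range_eqI[of _ _ "(lower x, upper x)"]) simp
  qed
  then show "finite (UNIV :: 'a elw set)" by (metis finite finite_imageI)
qed

definition elw_sharp :: "'q elw \<Rightarrow> 'q elw" where
  "elw_sharp x = Elw (lw_sharp (lower x)) (upper x)"

lemma elw_simps [simp]:
  "lower (x * y) = lw_mult (lower x) (lower y)" "upper (x * y) = lw_mult (upper x) (upper y)"
  "lower 1 = lw_one" "upper 1 = lw_one"
  "lower (elw_sharp x) = lw_sharp (lower x)" "upper (elw_sharp x) = upper x"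
  by (simp_all add: times_elw_def one_elw_def elw_sharp_def)

lemma elw_idempotent_iff: "x * x = x \<longleftrightarrow> lw_idempotent (lower x) \<and> lw_idempotent (upper x)"
  by (cases x) (auto simp: times_elw_def lw_idempotent_def)

section \<open>Generated pairs and their realisation by words\<close>

inductive_set extended_monoid :: "('q, 'a) pa \<Rightarrow> 'q elw set" for A where
  letter: "Elw (letter_lw A a) (letter_lw A a) \<in> extended_monoid A"
| one: "1 \<in> extended_monoid A"
| mult: "x \<in> extended_monoid A \<Longrightarrow> y \<in> extended_monoid A \<Longrightarrow> x * y \<in> extended_monoid A"
| sharp: "x \<in> extended_monoid A \<Longrightarrow> x * x = x \<Longrightarrow> elw_sharp x \<in> extended_monoid A"

lemma lower_extended_monoid: "x \<in> extended_monoid A \<Longrightarrow> lower x \<in> markov_monoid A"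
  by (induction rule: extended_monoid.induct)
    (auto simp: elw_idempotent_iff intro: markov_monoid.intros)

text \<open>The bound \<open>c\<close> is chosen before \<epsilon>: edges of \<open>lower x\<close>
  stay away from zero while all other entries become arbitrarily small.\<close>

definition reified :: "('q::finite, 'a) pa \<Rightarrow> 'q elw \<Rightarrow> bool" where
  "reified A x \<longleftrightarrow> (\<exists>c>0. \<forall>\<epsilon>>0. \<exists>w. supp (word_mat A w) = upper x \<and>
     (\<forall>s t. lower x s t \<longrightarrow> c \<le> word_mat A w s t) \<and> (\<forall>s t. \<not> lower x s t \<longrightarrow> word_mat A w s t \<le> \<epsilon>))"

text \<open>Compactness of the unit cube, with matrices read as vectors; nonnegativity and row sums
  pass to the limit.\<close>

lemma convergent_subsequence:
  fixes B :: "nat \<Rightarrow> 'q::finite mat"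
  assumes "\<And>n. stochastic (B n)"
  obtains M r where "strict_mono r" "\<And>s t. (\<lambda>n. B (r n) s t) \<longlonglongrightarrow> M s t" "stochastic M"
proof -
  define f :: "nat \<Rightarrow> real ^ ('q \<times> 'q)" where "f n = (\<chi> p. B n (fst p) (snd p))" for n
  have "range f \<subseteq> cbox 0 1"
    using stochastic_nonneg[OF assms] stochastic_le_one[OF assms] by (auto simp: f_def mem_box_cart)
  then have "bounded (range f)" using bounded_cbox bounded_subset by blast
  then obtain l r where r: "strict_mono r" "(f \<circ> r) \<longlonglongrightarrow> l"
    using bounded_imp_convergent_subsequence by blast
  define M where "M s t = l $ (s, t)" for s t
  have lim: "(\<lambda>n. B (r n) s t) \<longlonglongrightarrow> M s t" for s t
    using tendsto_vec_nth[OF r(2), of "(s, t)"] by (simp add: f_def M_def o_def)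
  have "0 \<le> M s t" for s t
    by (rule LIMSEQ_le_const[OF lim]) (use assms in \<open>auto simp: stochastic_def\<close>)
  moreover have "(\<Sum>t\<in>UNIV. M s t) = 1" for s
  proof (rule LIMSEQ_unique)
    show "(\<lambda>n. \<Sum>t\<in>UNIV. B (r n) s t) \<longlonglongrightarrow> (\<Sum>t\<in>UNIV. M s t)"
      by (rule tendsto_sum) (rule lim)
    show "(\<lambda>n. \<Sum>t\<in>UNIV. B (r n) s t) \<longlonglongrightarrow> 1"
      using assms by (simp add: stochastic_def)
  qed
  ultimately have "stochastic M" by (simp add: stochastic_def)
  then show ?thesis by (rule that[OF r(1) lim])
qed

lemma reified_sequence:
  assumes "reified A x"
  obtains w M where "\<And>n. supp (word_mat A (w n)) = upper x" "stochastic M" "supp M = lower x"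
    "\<And>s t. (\<lambda>n. word_mat A (w n) s t) \<longlonglongrightarrow> M s t"
proof -
  obtain c where c: "0 < c" and ex: "\<forall>\<epsilon>>0. \<exists>w. supp (word_mat A w) = upper x \<and>
     (\<forall>s t. lower x s t \<longrightarrow> c \<le> word_mat A w s t) \<and> (\<forall>s t. \<not> lower x s t \<longrightarrow> word_mat A w s t \<le> \<epsilon>)"
    using assms unfolding reified_def by blast
  have "\<forall>n. \<exists>w. supp (word_mat A w) = upper x \<and> (\<forall>s t. lower x s t \<longrightarrow> c \<le> word_mat A w s t) \<and>
      (\<forall>s t. \<not> lower x s t \<longrightarrow> word_mat A w s t \<le> inverse (real (Suc n)))"
    using ex by simp
  then obtain w where w: "\<And>n. supp (word_mat A (w n)) = upper x"
    "\<And>n s t. lower x s t \<Longrightarrow> c \<le> word_mat A (w n) s t"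
    "\<And>n s t. \<not> lower x s t \<Longrightarrow> word_mat A (w n) s t \<le> inverse (real (Suc n))"
    by metis
  obtain M r where r: "strict_mono r" "stochastic M" "\<And>s t. (\<lambda>n. word_mat A (w (r n)) s t) \<longlonglongrightarrow> M s t"
    using convergent_subsequence[of "\<lambda>n. word_mat A (w n)"] stochastic_word by metis
  have "0 < M s t \<longleftrightarrow> lower x s t" for s t
  proof (cases "lower x s t")
    case True
    then have "c \<le> M s t" by (intro LIMSEQ_le_const[OF r(3)]) (use w in blast)
    then show ?thesis using True c by simp
  next
    case False
    have "(\<lambda>n. inverse (real (Suc (r n)))) \<longlonglongrightarrow> 0"
      using LIMSEQ_subseq_LIMSEQ[OF LIMSEQ_inverse_real_of_nat r(1)] by (simp add: o_def)
    from LIMSEQ_le[OF r(3) this] have "M s t \<le> 0" using w(3)[OF False] by blast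
    then show ?thesis using False by simp
  qed
  then show ?thesis using that[of "\<lambda>n. w (r n)" M] w(1) r(2,3) by blast
qed

lemma mats_replicate_tendsto:
  assumes "\<And>s t. (\<lambda>n. B n s t) \<longlonglongrightarrow> M s t"
  shows "(\<lambda>n. mats (replicate k (B n)) s t) \<longlonglongrightarrow> mats (replicate k M) s t"
proof (induction k arbitrary: s t)
  case (Suc k)
  then show ?case using assms by (auto simp: mat_mult_def intro!: tendsto_sum tendsto_mult)
qed simp

text \<open>Two successive limits: first \<open>k\<close> makes the entries of \<open>M k\<close>
  outside \<open>lower x\<close> small, then \<open>n\<close> brings a word matrix close to
  \<open>M k\<close>. The bound is halved to leave room for the second approximation.\<close>

lemma reifiedI:
  fixes A :: "('q::finite, 'a) pa"
  assumes c: "0 < c" "\<And>k s t. lower x s t \<Longrightarrow> c \<le> M k s t"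
    and M: "\<And>s t. \<not> lower x s t \<Longrightarrow> (\<lambda>k. M k s t) \<longlonglongrightarrow> 0"
    and w: "\<And>k n. supp (word_mat A (w k n)) = upper x" "\<And>k s t. (\<lambda>n. word_mat A (w k n) s t) \<longlonglongrightarrow> M k s t"
  shows "reified A x"
  unfolding reified_def
proof (intro exI[of _ "c / 2"] conjI allI impI)
  fix \<epsilon> :: real
  assume "0 < \<epsilon>"
  have "eventually (\<lambda>k. \<not> lower x s t \<longrightarrow> M k s t < \<epsilon>) sequentially" for s t
    using order_tendstoD(2)[OF M \<open>0 < \<epsilon>\<close>] by (cases "lower x s t") auto
  then have "eventually (\<lambda>k. \<forall>s t. \<not> lower x s t \<longrightarrow> M k s t < \<epsilon>) sequentially"
    by (intro eventually_all_finite)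
  from eventually_happens'[OF sequentially_bot this]
  obtain k where k: "\<And>s t. \<not> lower x s t \<Longrightarrow> M k s t < \<epsilon>" by blast
  have "eventually (\<lambda>n. (lower x s t \<longrightarrow> c / 2 < word_mat A (w k n) s t) \<and>
      (\<not> lower x s t \<longrightarrow> word_mat A (w k n) s t < \<epsilon>)) sequentially" for s t
  proof (cases "lower x s t")
    case True
    then have "c / 2 < M k s t" using c(1) c(2)[OF True, of k] by linarith
    from order_tendstoD(1)[OF w(2) this] show ?thesis using True by simp
  next
    case False
    then show ?thesis using order_tendstoD(2)[OF w(2) k] by simp
  qed
  then have "eventually (\<lambda>n. \<forall>s t. (lower x s t \<longrightarrow> c / 2 < word_mat A (w k n) s t) \<and>
      (\<not> lower x s t \<longrightarrow> word_mat A (w k n) s t < \<epsilon>)) sequentially"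
    by (intro eventually_all_finite)
  from eventually_happens'[OF sequentially_bot this]
  obtain n where "\<forall>s t. (lower x s t \<longrightarrow> c / 2 < word_mat A (w k n) s t) \<and>
      (\<not> lower x s t \<longrightarrow> word_mat A (w k n) s t < \<epsilon>)" by blast
  then show "\<exists>w. supp (word_mat A w) = upper x \<and> (\<forall>s t. lower x s t \<longrightarrow> c / 2 \<le> word_mat A w s t) \<and>
      (\<forall>s t. \<not> lower x s t \<longrightarrow> word_mat A w s t \<le> \<epsilon>)"
    using w(1) by (intro exI[of _ "w k n"]) (auto intro: less_imp_le)
qed (use c in simp)

lemma reified_constant:
  assumes "stochastic M" "supp M = lower x"
    and "\<And>n. supp (word_mat A (w n)) = upper x" "\<And>s t. (\<lambda>n. word_mat A (w n) s t) \<longlonglongrightarrow> M s t"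
  shows "reified A x"
proof -
  obtain c where c: "0 < c" "\<And>s t. 0 < M s t \<Longrightarrow> c \<le> M s t"
    using ex_positive_lower_bound[of "\<lambda>(s, t). M s t"] by auto
  have iff: "0 < M s t \<longleftrightarrow> lower x s t" for s t using assms(2) by metis
  have zero: "M s t = 0" if "\<not> lower x s t" for s t
    using that iff[of s t] stochastic_nonneg[OF assms(1), of s t] by simp
  show ?thesis
    by (rule reifiedI[where c = c and M = "\<lambda>_. M" and w = "\<lambda>_. w"]) (use assms(3,4) c iff zero in simp_all)
qed

lemma reified_word: "reified A (Elw (supp (word_mat A w)) (supp (word_mat A w)))"
  by (rule reified_constant[where M = "word_mat A w" and w = "\<lambda>_. w"]) (simp_all add: stochastic_word)

lemma reified_mult:
  fixes A :: "('q::finite, 'a) pa"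
  assumes "reified A x" "reified A y"
  shows "reified A (x * y)"
proof -
  obtain v M where v: "\<And>n. supp (word_mat A (v n)) = upper x" "stochastic M" "supp M = lower x"
    "\<And>s t. (\<lambda>n. word_mat A (v n) s t) \<longlonglongrightarrow> M s t" using reified_sequence[OF assms(1)] by metis
  obtain w N where w: "\<And>n. supp (word_mat A (w n)) = upper y" "stochastic N" "supp N = lower y"
    "\<And>s t. (\<lambda>n. word_mat A (w n) s t) \<longlonglongrightarrow> N s t" using reified_sequence[OF assms(2)] by metis
  show ?thesis
  proof (rule reified_constant[where M = "mat_mult M N" and w = "\<lambda>n. v n @ w n"])
    show "(\<lambda>n. word_mat A (v n @ w n) s t) \<longlonglongrightarrow> mat_mult M N s t" for s t
      unfolding word_mat_append mat_mult_def by (intro tendsto_sum tendsto_mult v w)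
  qed (simp_all add: word_mat_append supp_mult stochastic_mult stochastic_word v w)
qed

text \<open>Powers of the realising words tend to powers of \<open>M\<close>, whose transient
  columns vanish as the exponent grows. Idempotence of \<open>upper x\<close> keeps the support
  unchanged.\<close>

lemma reified_sharp:
  fixes A :: "('q::finite, 'a) pa"
  assumes "reified A x" "x * x = x"
  shows "reified A (elw_sharp x)"
proof -
  obtain w M where w: "\<And>n. supp (word_mat A (w n)) = upper x" "stochastic M" "supp M = lower x"
    "\<And>s t. (\<lambda>n. word_mat A (w n) s t) \<longlonglongrightarrow> M s t" using reified_sequence[OF assms(1)] by metis
  have idem: "lw_idempotent (supp M)" "lw_idempotent (upper x)"
    using assms(2) w(3) by (simp_all add: elw_idempotent_iff)
  obtain c where c: "0 < c" "c \<le> 1" "\<And>s t. 0 < M s t \<Longrightarrow> c \<le> M s t"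
    using ex_positive_lower_bound[of "\<lambda>(s, t). M s t"] by auto
  show ?thesis
  proof (rule reifiedI[where c = "c\<^sup>2" and M = "\<lambda>k. mats (replicate (Suc k) M)"
        and w = "\<lambda>k n. concat (replicate (Suc k) (w n))"])
    show "0 < c\<^sup>2" using c by simp
    show "c\<^sup>2 \<le> mats (replicate (Suc k) M) s t" if "lower (elw_sharp x) s t" for k s t
    \<comment> \<open>Both relations are \<open>supp M\<close> here, so the condition against leaks
      is trivial.\<close>
    proof (rule mats_sharp_lower_bound[OF idem(1) stochastic_limit_word[OF w(2)] idem(1)])
      show "lw_sharp (supp M) s t" using that w(3) by simp
    qed (use w(2) c in auto)
    show "(\<lambda>k. mats (replicate (Suc k) M) s t) \<longlonglongrightarrow> 0" if "\<not> lower (elw_sharp x) s t" for s t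
      by (rule replicate_transient_tendsto) (use that w(2,3) idem in simp_all)
    show "supp (word_mat A (concat (replicate (Suc k) (w n)))) = upper (elw_sharp x)" for k n
      unfolding word_mat_concat elw_simps
      by (rule supp_mats_idempotent) (use idem w(1) stochastic_word in auto)
    show "(\<lambda>n. word_mat A (concat (replicate (Suc k) (w n))) s t) \<longlonglongrightarrow> mats (replicate (Suc k) M) s t" for k s t
      unfolding word_mat_concat map_replicate by (rule mats_replicate_tendsto) (rule w)
  qed
qed

lemma extended_monoid_reified:
  fixes A :: "('q::finite, 'a) pa"
  shows "x \<in> extended_monoid A \<Longrightarrow> reified A x"
proof (induction rule: extended_monoid.induct)
  case (letter a)
  have "supp (word_mat A [a]) = letter_lw A a" by (simp add: letter_lw_def letter_mat_def)
  then show ?case using reified_word[of A "[a]"] by simp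
next
  case one
  show ?case using reified_word[of A "[]"] by (simp add: supp_one one_elw_def)
qed (auto intro: reified_mult reified_sharp)

text \<open>Otherwise the words realising \<open>x\<close> form a leak: their probability from
  \<open>r\<close> to \<open>q\<close> is always positive but tends to zero, and both states are
  recurrent in the limit.\<close>

lemma leaktight_no_leak:
  fixes A :: "('q::finite, 'a) pa"
  assumes "leaktight A" "x \<in> extended_monoid A" "x * x = x"
    and "lw_recurrent (lower x) r" "lw_recurrent (lower x) q" "upper x r q"
  shows "lower x r q"
proof (rule ccontr)
  assume not: "\<not> lower x r q"
  obtain w M where w: "\<And>n. supp (word_mat A (w n)) = upper x" "stochastic M" "supp M = lower x"
    "\<And>s t. (\<lambda>n. word_mat A (w n) s t) \<longlonglongrightarrow> M s t"
    using reified_sequence[OF extended_monoid_reified[OF assms(2)]] by metis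
  have idem: "lw_idempotent (lower x)" "lw_idempotent (upper x)"
    using assms(3) by (simp_all add: elw_idempotent_iff)
  have idem_mat: "idempotent_mat N" if "stochastic N" "lw_idempotent (supp N)" for N :: "'q mat"
    using that supp_mult[OF that(1) that(1)] unfolding lw_idempotent_def idempotent_mat_def
    by (simp add: fun_eq_iff)
  have iff: "0 < M s t \<longleftrightarrow> lower x s t" for s t using w(3) by metis
  \<comment> \<open>The support of \<open>M\<close> is its own transitive closure, so the two
    notions of recurrence agree.\<close>
  have "Relation.trans {(s, t). 0 < M s t}"
    unfolding iff by (auto intro!: transI dest: lw_idempotentD[OF idem(1)])
  then have rec: "mc_recurrent M s" if "lw_recurrent (lower x) s" for s
    using that by (simp add: mc_recurrent_def trancl_id iff lw_recurrent_def)
  have "M r q = 0" using not iff[of r q] stochastic_nonneg[OF w(2), of r q] by simp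
  then have "(\<lambda>n. prob_path A r (w n) q) \<longlonglongrightarrow> 0" using w(4)[of r q] by (simp add: prob_path_def)
  moreover have "\<forall>n. 0 < prob_path A r (w n) q"
    using w(1) assms(6) unfolding prob_path_def by metis
  moreover have "idempotent_word A (w n)" for n
    unfolding idempotent_word_def by (rule idem_mat[OF stochastic_word]) (simp only: w(1) idem(2))
  moreover have "idempotent_mat M" using idem_mat w(2,3) idem(1) by simp
  ultimately have "is_leak A w"
    unfolding is_leak_def using rec assms(4,5) w(4) by blast
  then show False using assms(1) by (auto simp: leaktight_def)
qed

subsection \<open>Uniform lower bounds\<close>

text \<open>The exponent \<open>2 ^ n\<close> reflects that each level of a tree squares the lower
  bound.\<close>

definition approx :: "('q::finite, 'a) pa \<Rightarrow> real \<Rightarrow> nat \<Rightarrow> 'a list \<Rightarrow> 'q elw \<Rightarrow> bool" where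
  "approx A c n w x \<longleftrightarrow> x \<in> extended_monoid A \<and> supp (word_mat A w) = upper x \<and>
     (\<forall>s t. lower x s t \<longrightarrow> c ^ (2 ^ n) \<le> word_mat A w s t)"

lemma approx_mult:
  assumes "approx A c n v x" "approx A c n w y" "0 < c"
  shows "approx A c (Suc n) (v @ w) (x * y)"
proof -
  have "c ^ (2 ^ Suc n) \<le> word_mat A (v @ w) s t" if st: "lower (x * y) s t" for s t
  proof -
    obtain q where q: "lower x s q" "lower y q t" using st by (auto simp: lw_mult_def)
    have "c ^ (2 ^ Suc n) = c ^ (2 ^ n) * c ^ (2 ^ n)" by (simp add: mult_2 power_add)
    also have "\<dots> \<le> word_mat A v s q * word_mat A w q t"
      using assms q by (intro mult_mono) (auto simp: approx_def intro: stochastic_nonneg stochastic_word)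
    also have "\<dots> \<le> word_mat A (v @ w) s t"
      unfolding word_mat_append by (rule mat_mult_ge[OF stochastic_word stochastic_word])
    finally show ?thesis .
  qed
  then show ?thesis
    using assms by (auto simp: approx_def word_mat_append supp_mult stochastic_word intro: extended_monoid.mult)
qed

lemma extended_monoid_limit_word: "x \<in> extended_monoid A \<Longrightarrow> is_limit_word (lower x)"
  for A :: "('q::finite, 'a) pa"
  by (intro markov_monoid_limit_word lower_extended_monoid)

lemma extended_monoid_lower_imp_upper:
  fixes A :: "('q::finite, 'a) pa"
  shows "x \<in> extended_monoid A \<Longrightarrow> lower x s t \<Longrightarrow> upper x s t"
proof (induction arbitrary: s t rule: extended_monoid.induct)
  case (mult x y)
  then show ?case by (simp add: lw_mult_def) blast
next
  case (sharp x)
  then show ?case by (simp add: lw_sharp_def)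
qed simp_all

text \<open>Leaktightness enters here: it supplies the condition under which iteration over any
  number of words only squares the bound.\<close>

lemma approx_sharp:
  fixes A :: "('q::finite, 'a) pa"
  assumes "leaktight A" "0 < c" "c \<le> 1" "e * e = e" "ws \<noteq> []" "\<And>w. w \<in> set ws \<Longrightarrow> approx A c n w e"
  shows "approx A c (Suc n) (concat ws) (elw_sharp e)"
proof -
  have e: "e \<in> extended_monoid A"
    using assms(6)[of "hd ws"] assms(5) by (simp add: approx_def)
  have idem: "lw_idempotent (lower e)" "lw_idempotent (upper e)"
    using assms(4) by (simp_all add: elw_idempotent_iff)
  let ?Bs = "map (word_mat A) ws"
  have Bs: "stochastic B" "supp B = upper e" "lower e s t \<Longrightarrow> c ^ (2 ^ n) \<le> B s t" if "B \<in> set ?Bs" for B s t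
    using that assms(6) stochastic_word by (auto simp: approx_def)
  have "supp (mats ?Bs) = upper e"
    by (rule supp_mats_idempotent[OF idem(2)]) (use assms(5) Bs in auto)
  moreover have "c ^ (2 ^ Suc n) \<le> mats ?Bs s t" if st: "lw_sharp (lower e) s t" for s t
  proof -
    have "(c ^ (2 ^ n))\<^sup>2 \<le> mats ?Bs s t"
    proof (rule mats_sharp_lower_bound[OF idem(1) extended_monoid_limit_word[OF e] idem(2)])
      show "lower e r q" if "lw_recurrent (lower e) r" "lw_recurrent (lower e) q" "upper e r q" for r q
        by (rule leaktight_no_leak[OF assms(1) e assms(4) that])
      show "upper e s t" if "B \<in> set ?Bs" "0 < B s t" for B s t
        using Bs(2)[OF that(1)] that(2) by metis
    qed (use assms(2,3,5) Bs(1,3) st extended_monoid_lower_imp_upper[OF e] in \<open>auto intro: power_le_one\<close>)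
    then show ?thesis by (simp add: power_mult[symmetric] mult.commute)
  qed
  ultimately show ?thesis
    using e assms(4) by (auto simp: approx_def word_mat_concat intro: extended_monoid.sharp)
qed

lemma approx_letter:
  fixes A :: "('q::finite, 'a) pa"
  assumes "\<And>s t. 0 < letter_mat A a s t \<Longrightarrow> c \<le> letter_mat A a s t"
  shows "approx A c 0 [a] (Elw (letter_lw A a) (letter_lw A a))"
  using assms extended_monoid.letter[of A a] by (auto simp: approx_def letter_lw_def letter_mat_def)

text \<open>The trees have height at most some \<open>N\<close>, so \<delta> can be
  \<open>c ^ (2 ^ N)\<close>, with \<open>c\<close> a positive lower bound for all nonzero letter
  probabilities.\<close>

lemma leaktight_approx:
  fixes A :: "('q::finite, 'a::finite) pa"
  assumes "leaktight A"
  obtains \<delta> where "0 < \<delta>" "\<And>w. \<exists>x\<in>extended_monoid A. \<forall>s t. lower x s t \<longrightarrow> \<delta> \<le> word_mat A w s t"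
proof -
  obtain c where c: "0 < c" "c \<le> 1" "\<And>a s t. 0 < letter_mat A a s t \<Longrightarrow> c \<le> letter_mat A a s t"
    using ex_positive_lower_bound[of "\<lambda>(a, s, t). letter_mat A a s t"] by auto
  interpret factorisation "approx A c" elw_sharp
  proof
    fix n m w and x :: "'q elw"
    assume "approx A c n w x" "n \<le> m"
    moreover have "c ^ (2 ^ m) \<le> c ^ (2 ^ n)"
      using c \<open>n \<le> m\<close> by (intro power_decreasing power_increasing) auto
    ultimately show "approx A c m w x" unfolding approx_def by (meson order_trans)
  next
    fix n
    have "c ^ (2 ^ n) \<le> 1" using c by (intro power_le_one) auto
    then show "approx A c n [] 1"
      by (auto simp: approx_def supp_one intro: extended_monoid.one) (auto simp: lw_one_def mat_one_def)
  next
    fix n w and e :: "'q elw"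
    assume "approx A c n w e" "e * e = e"
    then have "lw_idempotent (lower e)" "is_limit_word (lower e)" "lw_mult (upper e) (upper e) = upper e"
      using extended_monoid_limit_word by (auto simp: approx_def elw_idempotent_iff lw_idempotent_def)
    then show "e * elw_sharp e = elw_sharp e" "elw_sharp e * e = elw_sharp e" "elw_sharp e * elw_sharp e = elw_sharp e"
      by (simp_all add: elw_sharp_def times_elw_def mult_lw_sharp lw_sharp_mult lw_sharp_sharp)
  qed (use approx_mult approx_sharp[OF assms c(1,2)] c(1) in blast)+
  obtain N where N: "\<And>w. \<exists>x. approx A c N w x"
    using bounded_eval[of 0] approx_letter[OF c(3)] by metis
  show ?thesis
  proof (rule that)
    show "\<exists>x\<in>extended_monoid A. \<forall>s t. lower x s t \<longrightarrow> c ^ (2 ^ N) \<le> word_mat A w s t" for w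
      using N[of w] unfolding approx_def by blast
  qed (use c in simp)
qed

theorem theorem3p3:
  fixes A :: "('q::finite, 'a::finite) pa"
  assumes "leaktight A"
  shows "\<forall>u :: nat \<Rightarrow> 'a list. \<exists>w \<in> markov_monoid A. is_limit_word w \<and>
           (\<forall>s t. limsup (\<lambda>n. ereal (prob_path A s (u n) t)) = 0 \<longrightarrow> \<not> w s t)"
proof
  fix u :: "nat \<Rightarrow> 'a list"
  obtain \<delta> where \<delta>: "0 < \<delta>" "\<And>w. \<exists>x\<in>extended_monoid A. \<forall>s t. lower x s t \<longrightarrow> \<delta> \<le> word_mat A w s t"
    using leaktight_approx[OF assms] by blast
  have "\<forall>n. \<exists>x. x \<in> extended_monoid A \<and> (\<forall>s t. lower x s t \<longrightarrow> \<delta> \<le> word_mat A (u n) s t)"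
    using \<delta>(2) by blast
  then obtain x where x: "\<And>n. x n \<in> extended_monoid A" "\<And>n s t. lower (x n) s t \<Longrightarrow> \<delta> \<le> word_mat A (u n) s t"
    by metis
  \<comment> \<open>There are only finitely many pairs, so one of them serves infinitely many
    indices.\<close>
  obtain m where m: "infinite {n. x n = x m}"
    using pigeonhole_infinite[of UNIV x] by auto
  have "\<not> lower (x m) s t" if lim: "limsup (\<lambda>n. ereal (prob_path A s (u n) t)) = 0" for s t
  proof
    assume "lower (x m) s t"
    \<comment> \<open>A zero limit superior pushes the probabilities below \<delta> from some index
      on, against the bound at infinitely many indices.\<close>
    have "eventually (\<lambda>n. ereal (prob_path A s (u n) t) < ereal \<delta>) sequentially"
      by (rule Limsup_lessD) (use lim \<delta>(1) in simp)
    then obtain K where K: "\<And>n. n \<ge> K \<Longrightarrow> word_mat A (u n) s t < \<delta>"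
      by (auto simp: eventually_sequentially prob_path_def)
    obtain n where "n \<ge> K" "x n = x m"
      using m by (auto simp: infinite_nat_iff_unbounded_le)
    then show False using K[of n] x(2)[of n s t] \<open>lower (x m) s t\<close> by simp
  qed
  then show "\<exists>w \<in> markov_monoid A. is_limit_word w \<and>
      (\<forall>s t. limsup (\<lambda>n. ereal (prob_path A s (u n) t)) = 0 \<longrightarrow> \<not> w s t)"
    using lower_extended_monoid[OF x(1)] extended_monoid_limit_word[OF x(1)] by blast
qed

end
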